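(* Consider the family of matrices $$\mathbf{A}^{(0)}=\begin{pmatrix}\mathbf{L}&\mathbf{0}\\ 0&\mathbf{0}\end{pmatrix}\in\mathbb{R}^{m\times n},\qquad \mathbf{A}^{(j)}=\begin{pmatrix}\mathbf{L}&\mathbf{0}\\ 0&h\,\mathbf{e}_j^\top\end{pmatrix}\in\mathbb{R}^{m\times n},\qquad j=1,\dots,d,$$ where $\mathbf{L}\in\mathbb{R}^{\bar m\times\bar n}$ has rank one and $\|\mathbf{L}\|_F=1$, $m=\bar m+1$, $n=\bar n+d$, $h>0$, and $\mathbf{e}_j\in\mathbb{R}^d$ denotes the $j$-th canonical basis vector. Assume a CUR approximation $\mathbf{A}^{(j)}_{\mathrm{CUR}}$ of each $\mathbf{A}^{(j)}$, $j=0,\dots,d$, is given, and that for each $\mathbf{A}^{(j)}$, $j\ge 1$, the column corresponding to $h$ is not captured by the approximation, i.e., the CUR residuals are $$\mathbf{A}^{(0)}-\mathbf{A}^{(0)}_{\mathrm{CUR}}=\begin{pmatrix}\mathbf{F}_L&\mathbf{0}\\ 0&\mathbf{0}\end{pmatrix},\qquad \mathbf{A}^{(j)}-\mathbf{A}^{(j)}_{\mathrm{CUR}}=\begin{pmatrix}\mathbf{F}_L&\mathbf{0}\\ 0&h\,\mathbf{e}_j^\top\end{pmatrix},\qquad j=1,\dots,d,$$ where $\|\mathbf{F}_L\|_F=\varepsilon_L$. Define $\mathcal{T}:=\{\bar n+j:\ j\in\{1,\dots,d\}\}$, fix $\delta>1$, and assume that $h^2>(\delta^2-1)\varepsilon_L^2$.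 Finally, assume that all information available to the estimator prior to its additional column queries is identical across the matrices $\mathbf{A}^{(0)},\dots,\mathbf{A}^{(d)}$. Then, for every target success probability $\pi\in(1/2,1)$, there does not exist a randomized, possibly adaptive, algorithm that inspects at most $q$ columns, where $$q<(2\pi-1)|\mathcal{T}|,$$ and outputs a $\delta$-approximation of $\|\mathbf{A}-\mathbf{A}_{\mathrm{CUR}}\|_F^2$ with probability at least $\pi$ for every input $\mathbf{A}\in\{\mathbf{A}^{(0)},\mathbf{A}^{(1)},\dots,\mathbf{A}^{(d)}\}$ (with $\mathbf{A}_{\mathrm{CUR}}$ the corresponding given CUR approximation). In particular, any such algorithm requires $q=\Omega(|\mathcal{T}|)=\Omega(d)$ column queries in the worst case.
   Context: $\|\cdot\|_F$ is the Frobenius norm. CUR approximation: given index sets $\mathcal{I}$ (rows) and $\mathcal{J}$ (columns) of a matrix $\mathbf{A}$ (indexing linearly independent rows, respectively columns), $\mathbf{A}_{\mathrm{CUR}}=\mathbf{A}(:,\mathcal{J})\,\mathbf{A}(\mathcal{I},\mathcal{J})^{\dagger}\,\mathbf{A}(\mathcal{I},:)$, where $\dagger$ denotes the Moore-Penrose pseudoinverse. In the claim only the stated form of the residuals is used. $\delta$-approximation: for $\delta>1$, a number $v$ is a $\delta$-approximation of $x\ge 0$ if $v\in[x/\delta,\ \delta x]$. Query model: the input is an unknown member $\mathbf{A}$ of the family $\{\mathbf{A}^{(0)},\dots,\mathbf{A}^{(d)}\}$. The algorithm starts with prior information that is the same for all members of the family, and then inspects at most $q$ columns: at each step it selects a column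 index in $\{1,\dots,n\}$ and observes the corresponding column of $\mathbf{A}$ (equivalently, of the residual $\mathbf{A}-\mathbf{A}_{\mathrm{CUR}}$). A deterministic adaptive algorithm chooses each index as a function of the prior information and of the columns observed so far, and outputs a real number that is a function of the prior information and all observations. A randomized adaptive algorithm is a probability distribution over such deterministic algorithms; its success probability on an input is taken over this internal randomness. $\Omega(d)$ denotes a lower bound by a positive constant (depending only on $\pi$) times $d$. *)

theory Defs
  imports
    "HOL-Probability.Probability_Measure"
    "Jordan_Normal_Form.DL_Rank_Submatrix"
begin

hide_const (open) Finite_Cartesian_Product.row Finite_Cartesian_Product.vec
hide_type (open) Finite_Cartesian_Product.vec

definition frobenius_norm :: "real mat \<Rightarrow> real" where
  "frobenius_norm A = sqrt (\<Sum>i<dim_row A. \<Sum>j<dim_col A. (A $$ (i, j))\<^sup>2)"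

definition is_pseudoinverse :: "real mat \<Rightarrow> real mat \<Rightarrow> bool" where
  "is_pseudoinverse A X \<longleftrightarrow>
     X \<in> carrier_mat (dim_col A) (dim_row A) \<and>
     A * X * A = A \<and> X * A * X = X \<and>
     transpose_mat (A * X) = A * X \<and> transpose_mat (X * A) = X * A"

definition pseudoinverse :: "real mat \<Rightarrow> real mat" where
  "pseudoinverse A = (THE X. is_pseudoinverse A X)"

lemma is_pseudoinverse_unique:
  assumes "is_pseudoinverse A X" "is_pseudoinverse A Y"
  shows "X = Y"
proof -
  define m n where "m = dim_row A" and "n = dim_col A"
  have A: "A \<in> carrier_mat m n" and X: "X \<in> carrier_mat n m" and Y: "Y \<in> carrier_mat n m"
    using assms by (auto simp: is_pseudoinverse_def m_def n_def)
  have x: "A * X * A = A" "X * A * X = X" "(A * X)\<^sup>T = A * X" "(X * A)\<^sup>T = X * A"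
    and y: "A * Y * A = A" "Y * A * Y = Y" "(A * Y)\<^sup>T = A * Y" "(Y * A)\<^sup>T = Y * A"
    using assms by (auto simp: is_pseudoinverse_def)
  have AX: "A * X \<in> carrier_mat m m" and AY: "A * Y \<in> carrier_mat m m"
    and XA: "X * A \<in> carrier_mat n n" and YA: "Y * A \<in> carrier_mat n n"
    using A X Y by auto
  have "A * Y * (A * X) = A * X"
    using assoc_mult_mat[OF AY A X] y by simp
  then have "A * X = (A * Y * (A * X))\<^sup>T" using x by simp
  also have "\<dots> = A * X * (A * Y)"
    using transpose_mult[OF AY AX] x y by simp
  also have "\<dots> = A * Y"
    using assoc_mult_mat[OF AX A Y] x by simp
  finally have 1: "A * X = A * Y" .
  have "X * A * (Y * A) = X * A"
    using assoc_mult_mat[OF X A YA] assoc_mult_mat[OF A Y A] y by simp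
  then have "X * A = (X * A * (Y * A))\<^sup>T" using x by simp
  also have "\<dots> = Y * A * (X * A)"
    using transpose_mult[OF XA YA] x y by simp
  also have "\<dots> = Y * A"
    using assoc_mult_mat[OF Y A XA] assoc_mult_mat[OF A X A] x by simp
  finally have 2: "X * A = Y * A" .
  have "X = X * A * X" using x by simp
  also have "\<dots> = Y * (A * X)" using 2 assoc_mult_mat[OF Y A X] by simp
  also have "\<dots> = Y * A * Y" using 1 assoc_mult_mat[OF Y A Y] by simp
  also have "\<dots> = Y" using y by simp
  finally show ?thesis .
qed

lemma pseudoinverse_eqI: "is_pseudoinverse A X \<Longrightarrow> pseudoinverse A = X"
  unfolding pseudoinverse_def by (blast intro: is_pseudoinverse_unique)

text \<open>All row and column indices are 0-based. Injectivity of \<^term>\<open>row A\<close> and \<^term>\<open>col A\<close> on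
  the index sets is needed because \<open>lin_dep\<close> is a property of a set of vectors, in which
  repeated vectors would be identified.\<close>

definition cur_indices :: "real mat \<Rightarrow> nat set \<Rightarrow> nat set \<Rightarrow> bool" where
  "cur_indices A I J \<longleftrightarrow>
     I \<subseteq> {..<dim_row A} \<and> inj_on (row A) I \<and>
     \<not> module.lin_dep class_ring (module_vec TYPE(real) (dim_col A)) (row A ` I) \<and>
     J \<subseteq> {..<dim_col A} \<and> inj_on (col A) J \<and>
     \<not> module.lin_dep class_ring (module_vec TYPE(real) (dim_row A)) (col A ` J)"

definition cur_approx :: "real mat \<Rightarrow> nat set \<Rightarrow> nat set \<Rightarrow> real mat" where
  "cur_approx A I J =
     submatrix A UNIV J * pseudoinverse (submatrix A I J) * submatrix A I UNIV"

definition spike_row :: "nat \<Rightarrow> real \<Rightarrow> nat \<Rightarrow> real mat" where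
  "spike_row d h j = (if j = 0 then 0\<^sub>m 1 d else h \<cdot>\<^sub>m mat_of_row (unit_vec d (j - 1)))"

text \<open>The block matrix with diagonal blocks \<^term>\<open>B\<close> and \<^term>\<open>spike_row d h j\<close>. It describes
  both the family (\<open>B = L\<close>) and its CUR residuals (\<open>B = F\<close>); the index \<open>j = 0\<close> stands for the
  member without a spike, and for \<open>1 \<le> j \<le> d\<close> the entry \<open>h\<close> lies in the 0-based column
  \<open>dim_col B + j - 1\<close>.\<close>

definition spiked :: "real mat \<Rightarrow> nat \<Rightarrow> real \<Rightarrow> nat \<Rightarrow> real mat" where
  "spiked B d h j =
     four_block_mat B (0\<^sub>m (dim_row B) d) (0\<^sub>m 1 (dim_col B)) (spike_row d h j)"

definition spike_columns :: "nat \<Rightarrow> nat \<Rightarrow> nat set" where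
  "spike_columns nbar d = (\<lambda>j. nbar + j - 1) ` {1..d}"

text \<open>\<open>Is j\<close> and \<open>Js j\<close> are the row and column index sets of the CUR approximation of member \<open>j\<close>,
  and \<open>prior j\<close> is whatever an estimator is told about member \<open>j\<close> before querying columns.\<close>

locale spiked_cur_family =
  fixes mbar nbar d :: nat and L :: "real mat" and h :: real
    and Is Js :: "nat \<Rightarrow> nat set" and F :: "real mat" and eps \<delta> :: real
    and "prior" :: "nat \<Rightarrow> 'p"
  assumes L_carrier: "L \<in> carrier_mat mbar nbar"
    and L_rank: "vec_space.rank mbar L = 1"
    and L_norm: "frobenius_norm L = 1"
    and h_pos: "h > 0"
    and cur_indices: "\<And>j. j \<le> d \<Longrightarrow> cur_indices (spiked L d h j) (Is j) (Js j)"
    and F_carrier: "F \<in> carrier_mat mbar nbar"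
    and F_norm: "frobenius_norm F = eps"
    and residual: "\<And>j. j \<le> d \<Longrightarrow>
      spiked L d h j - cur_approx (spiked L d h j) (Is j) (Js j) = spiked F d h j"
    and delta_gt_1: "\<delta> > 1"
    and h_large: "h\<^sup>2 > (\<delta>\<^sup>2 - 1) * eps\<^sup>2"
    and prior_identical: "\<And>j. j \<le> d \<Longrightarrow> prior j = prior 0"

definition is_delta_approx :: "real \<Rightarrow> real \<Rightarrow> real \<Rightarrow> bool" where
  "is_delta_approx \<delta> x v \<longleftrightarrow> v \<in> {x / \<delta> .. \<delta> * x}"

text \<open>A deterministic adaptive strategy: either stop with an output, or query a column and continue
  depending on the column observed. Hence each query and the output are functions of all columns
  observed so far. A deterministic algorithm maps the prior information to such a strategy.\<close>

datatype strategy = Output real | Query nat "real vec \<Rightarrow> strategy"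

type_synonym 'p algorithm = "'p \<Rightarrow> strategy"

primrec run :: "strategy \<Rightarrow> real mat \<Rightarrow> real" where
  "run (Output v) A = v"
| "run (Query k s) A = run (s (col A k)) A"

primrec queries :: "strategy \<Rightarrow> real mat \<Rightarrow> nat list" where
  "queries (Output v) A = []"
| "queries (Query k s) A = k # queries (s (col A k)) A"

text \<open>A randomized algorithm is a probability measure on deterministic algorithms, with an arbitrary
  sigma-algebra. The query budget has to be respected on every input \<open>(p, A)\<close>, consisting of prior
  information \<open>p\<close> and matrix \<open>A\<close>.\<close>

definition randomized_algorithm ::
  "nat \<Rightarrow> ('p \<times> real mat) set \<Rightarrow> 'p algorithm measure \<Rightarrow> bool" where
  "randomized_algorithm q inputs R \<longleftrightarrow>
     prob_space R \<and>
     (\<forall>a\<in>space R. \<forall>(p, A)\<in>inputs.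
        length (queries (a p) A) \<le> q \<and> set (queries (a p) A) \<subseteq> {..<dim_col A})"

text \<open>If the success event is not measurable then the value below is \<open>0\<close>; hence requiring it to be
  at least a positive number includes measurability of the event.\<close>

definition success_prob ::
  "'p algorithm measure \<Rightarrow> 'p \<Rightarrow> real mat \<Rightarrow> real \<Rightarrow> real \<Rightarrow> real" where
  "success_prob R p A \<delta> x = measure R {a \<in> space R. is_delta_approx \<delta> x (run (a p) A)}"

definition estimates_cur_errors ::
  "nat \<Rightarrow> real mat \<Rightarrow> real \<Rightarrow> (nat \<Rightarrow> nat set) \<Rightarrow> (nat \<Rightarrow> nat set) \<Rightarrow> real \<Rightarrow> (nat \<Rightarrow> 'p) \<Rightarrow>
   real \<Rightarrow> nat \<Rightarrow> 'p algorithm measure \<Rightarrow> bool" where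
  "estimates_cur_errors d L h Is Js \<delta> prior \<pi> q R \<longleftrightarrow>
     randomized_algorithm q ((\<lambda>j. (prior j, spiked L d h j)) ` {0..d}) R \<and>
     (\<forall>j\<in>{0..d}. let A = spiked L d h j in
        success_prob R (prior j) A \<delta> ((frobenius_norm (A - cur_approx A (Is j) (Js j)))\<^sup>2) \<ge> \<pi>)"

end

(* On the input without a spike, any run that succeeds both there and on the j-th member must query
   the j-th spike column: otherwise both runs see the same columns and return the same value, while
   the two intervals of admissible values are disjoint. By the union bound this joint success has
   probability at least 2 \<pi> - 1 for each j, and one run can query at most q of the d columns, so
   d (2 \<pi> - 1) \<le> q by double counting. Arguing with the joint success events rather than with the
   events "column k is queried" matters, as the latter need not be measurable. *)

theory Submission
  imports Defs
begin

lemma sum_lessThan_add: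
  fixes f :: "nat \<Rightarrow> 'a::comm_monoid_add"
  shows "(\<Sum>i<m + n. f i) = (\<Sum>i<m. f i) + (\<Sum>i<n. f (m + i))"
  by (induction n) (simp_all add: add.assoc)

lemma frobenius_norm_sq:
  "(frobenius_norm A)\<^sup>2 = (\<Sum>i<dim_row A. \<Sum>j<dim_col A. (A $$ (i, j))\<^sup>2)"
  by (simp add: frobenius_norm_def sum_nonneg)

text \<open>Splitting the row and the column range at the block boundary turns the double sum into
  one sum per block.\<close>

lemma frobenius_norm_sq_four_block_mat:
  assumes "A \<in> carrier_mat m n" "B \<in> carrier_mat m n'" "C \<in> carrier_mat m' n" "D \<in> carrier_mat m' n'"
  shows "(frobenius_norm (four_block_mat A B C D))\<^sup>2 =
    (frobenius_norm A)\<^sup>2 + (frobenius_norm B)\<^sup>2 + (frobenius_norm C)\<^sup>2 + (frobenius_norm D)\<^sup>2"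
  using assms by (simp add: frobenius_norm_sq sum_lessThan_add sum.distrib)

lemma frobenius_norm_zero_mat [simp]: "frobenius_norm (0\<^sub>m m n) = 0"
  by (simp add: frobenius_norm_def)

lemma spike_row_carrier: "spike_row d h j \<in> carrier_mat 1 d"
  by (simp add: spike_row_def)

lemma frobenius_norm_sq_spike_row:
  assumes "1 \<le> j" "j \<le> d"
  shows "(frobenius_norm (spike_row d h j))\<^sup>2 = h\<^sup>2"
  \<comment> \<open>Moving the square inside the conditional from \<open>unit_vec\<close> lets the
    sum collapse to the single term with index \<open>j - 1\<close>.\<close>
  using assms by (simp add: frobenius_norm_sq spike_row_def mat_of_row_def
      if_distrib[of "\<lambda>x. (h * x)\<^sup>2"] cong: if_cong)

lemma frobenius_norm_sq_spiked:
  "(frobenius_norm (spiked F d h j))\<^sup>2 =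
    (frobenius_norm F)\<^sup>2 + (frobenius_norm (spike_row d h j))\<^sup>2"
  unfolding spiked_def
  by (subst frobenius_norm_sq_four_block_mat
        [of _ "dim_row F" "dim_col F" _ d _ 1, OF _ _ _ spike_row_carrier]) auto

lemma dim_col_spiked [simp]: "dim_col (spiked B d h j) = dim_col B + d"
  using spike_row_carrier[of d h j] by (simp add: spiked_def)

lemma col_spiked_eq:
  assumes "k < dim_col B + d" "k \<noteq> dim_col B + j - 1"
  shows "col (spiked B d h j) k = col (spiked B d h 0) k"
  by (rule eq_vecI) (use assms in \<open>auto simp: spiked_def spike_row_def mat_of_row_def unit_vec_def\<close>)

text \<open>Induction on the strategy: equal answers to the first query lead to the same
  continuation. Agreement is required only on the columns queried on \<open>A\<close>, so nothing
  about the queries on \<open>B\<close> has to be known beforehand.\<close>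

lemma run_cong:
  "(\<And>k. k \<in> set (queries s A) \<Longrightarrow> col A k = col B k) \<Longrightarrow> run s A = run s B"
  by (induction s) auto

lemma card_spike_columns: "card (spike_columns n d) = d"
proof -
  have "inj_on (\<lambda>j. n + j - 1) {1..d}" by (auto simp: inj_on_def)
  then show ?thesis by (simp add: spike_columns_def card_image)
qed

text \<open>Double counting: the expected number of events \<open>E j\<close> that occur is the sum
  of their probabilities, while pointwise this number never exceeds \<open>q\<close>.\<close>

lemma (in prob_space) card_mult_prob_le:
  assumes "finite J" and E: "\<And>j. j \<in> J \<Longrightarrow> E j \<in> events" "\<And>j. j \<in> J \<Longrightarrow> p \<le> prob (E j)"
    and q: "\<And>x. x \<in> space M \<Longrightarrow> card {j \<in> J. x \<in> E j} \<le> q"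
  shows "real (card J) * p \<le> real q"
proof -
  have "real (card J) * p \<le> (\<Sum>j\<in>J. prob (E j))"
    using E(2) by (rule sum_bounded_below)
  also have "\<dots> = (\<Sum>j\<in>J. expectation (indicator (E j)))"
    using E(1) by (intro sum.cong) (auto simp: Int_absorb2 sets.sets_into_space)
  also have "\<dots> = expectation (\<lambda>x. \<Sum>j\<in>J. indicator (E j) x)"
    using E(1) by (intro Bochner_Integration.integral_sum[symmetric])
      (auto simp: integrable_indicator_iff less_top[symmetric])
  also have "\<dots> \<le> expectation (\<lambda>_. real q)"
  proof (rule integral_mono)
    fix x assume "x \<in> space M"
    moreover have "(\<Sum>j\<in>J. indicator (E j) x) = real (card {j \<in> J. x \<in> E j})"
      using \<open>finite J\<close> by (simp add: indicator_def sum.If_cases Int_def)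
    ultimately show "(\<Sum>j\<in>J. indicator (E j) x) \<le> real q"
      using q by simp
  qed (use E(1) in \<open>auto intro!: Bochner_Integration.integrable_sum
      simp: integrable_indicator_iff less_top[symmetric]\<close>)
  finally show ?thesis by (simp add: prob_space)
qed

text \<open>Inclusion-exclusion, with the probability of the union bounded by 1.\<close>

lemma (in prob_space) prob_Int_ge:
  assumes "A \<in> events" "B \<in> events"
  shows "prob A + prob B - 1 \<le> prob (A \<inter> B)"
  using measure_Un3[OF fmeasurableI fmeasurableI, of A M B] assms prob_le_1[of "A \<union> B"]
  by (simp add: less_top[symmetric])

context spiked_cur_family
begin

text \<open>\<open>h_large\<close> says exactly that the upper end of the interval around
  \<open>eps\<^sup>2\<close> lies below the lower end of the interval around
  \<open>eps\<^sup>2 + h\<^sup>2\<close>.\<close>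

lemma is_delta_approx_disjoint:
  assumes "is_delta_approx \<delta> (eps\<^sup>2) v"
  shows "\<not> is_delta_approx \<delta> (eps\<^sup>2 + h\<^sup>2) v"
proof
  assume "is_delta_approx \<delta> (eps\<^sup>2 + h\<^sup>2) v"
  with assms have "(eps\<^sup>2 + h\<^sup>2) / \<delta> \<le> \<delta> * eps\<^sup>2"
    by (simp add: is_delta_approx_def)
  then have "eps\<^sup>2 + h\<^sup>2 \<le> \<delta>\<^sup>2 * eps\<^sup>2"
    using delta_gt_1 by (simp add: field_simps power2_eq_square)
  with h_large show False by (simp add: algebra_simps)
qed

text \<open>The conclusion concerns the queries on the spikeless input, a list that does not depend
  on \<open>j\<close>; this is what allows counting over all \<open>j\<close> at once.\<close>

lemma joint_success_queries_spike:
  assumes j: "1 \<le> j" "j \<le> d"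
    and range: "set (queries s (spiked L d h 0)) \<subseteq> {..<nbar + d}"
    and "is_delta_approx \<delta> (eps\<^sup>2) (run s (spiked L d h 0))"
    and "is_delta_approx \<delta> (eps\<^sup>2 + h\<^sup>2) (run s (spiked L d h j))"
  shows "nbar + j - 1 \<in> set (queries s (spiked L d h 0))"
proof (rule ccontr)
  assume "nbar + j - 1 \<notin> set (queries s (spiked L d h 0))"
  then have "run s (spiked L d h 0) = run s (spiked L d h j)"
    using range L_carrier by (intro run_cong col_spiked_eq[symmetric]) auto
  then show False using assms is_delta_approx_disjoint by auto
qed

lemma query_lower_bound:
  assumes est: "estimates_cur_errors d L h Is Js \<delta> prior \<pi> q R" and "\<pi> > 0"
  shows "real d * (2 * \<pi> - 1) \<le> real q"
proof -
  define A where "A j = spiked L d h j" for j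
  define x where "x j = (frobenius_norm (spiked F d h j))\<^sup>2" for j
  \<comment> \<open>Every \<open>S j\<close> uses \<open>prior 0\<close>, so all members face the
    same strategy \<open>a (prior 0)\<close>; \<open>prior_identical\<close> justifies this in
    \<open>prob_S\<close>.\<close>
  define S where "S j = {a \<in> space R. is_delta_approx \<delta> (x j) (run (a (prior 0)) (A j))}" for j
  from est interpret prob_space R
    by (simp add: estimates_cur_errors_def randomized_algorithm_def)
  have budget: "length (queries (a (prior 0)) (A 0)) \<le> q"
      "set (queries (a (prior 0)) (A 0)) \<subseteq> {..<nbar + d}" if "a \<in> space R" for a
    using est that L_carrier
    by (auto simp: estimates_cur_errors_def randomized_algorithm_def A_def)
  have prob_S: "\<pi> \<le> prob (S j)" if "j \<le> d" for j
    using est that residual[OF that] prior_identical[OF that]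
    by (auto simp: estimates_cur_errors_def success_prob_def S_def A_def x_def Let_def
        dest!: bspec[of _ _ j])
  \<comment> \<open>A non-measurable set has measure 0 by convention, so the positive bound \<pi>
    forces measurability.\<close>
  have S_events: "S j \<in> events" if "j \<le> d" for j
    using prob_S[OF that] \<open>\<pi> > 0\<close> measure_notin_sets[of "S j" R] by fastforce
  have x: "x 0 = eps\<^sup>2" "\<And>j. 1 \<le> j \<Longrightarrow> j \<le> d \<Longrightarrow> x j = eps\<^sup>2 + h\<^sup>2"
    using F_norm by (simp_all add: x_def frobenius_norm_sq_spiked frobenius_norm_sq_spike_row)
      (simp add: spike_row_def)
  have "real (card {1..d}) * (2 * \<pi> - 1) \<le> real q"
  proof (rule card_mult_prob_le[where E = "\<lambda>j. S 0 \<inter> S j"])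
    fix a assume a: "a \<in> space R"
    let ?Q = "queries (a (prior 0)) (A 0)"
    \<comment> \<open>Distinct members have distinct spike columns, and each jointly successful
      \<open>j\<close> has its column among the queries; truncated subtraction is harmless since
      \<open>j\<close> is at least 1.\<close>
    have "card {j \<in> {1..d}. a \<in> S 0 \<inter> S j} \<le> card (set ?Q)"
    proof (rule card_inj_on_le[where f = "\<lambda>j. nbar + j - 1"])
      show "(\<lambda>j. nbar + j - 1) ` {j \<in> {1..d}. a \<in> S 0 \<inter> S j} \<subseteq> set ?Q"
        using joint_success_queries_spike budget(2)[OF a] x by (auto simp: S_def A_def)
    qed (auto simp: inj_on_def)
    also have "\<dots> \<le> q"
      using card_length[of ?Q] budget(1)[OF a] by simp
    finally show "card {j \<in> {1..d}. a \<in> S 0 \<inter> S j} \<le> q" .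
  next
    fix j assume "j \<in> {1..d}"
    then show "2 * \<pi> - 1 \<le> prob (S 0 \<inter> S j)"
      using prob_Int_ge[OF S_events S_events, of 0 j] prob_S[of 0] prob_S[of j] by simp
  qed (auto intro: S_events)
  then show ?thesis by simp
qed

end

theorem theorem3:
  fixes \<pi> :: real
  assumes "1 / 2 < \<pi>" "\<pi> < 1"
  shows
    "(\<forall>mbar nbar d L h Is Js F eps \<delta> (prior :: nat \<Rightarrow> 'p) q.
        spiked_cur_family mbar nbar d L h Is Js F eps \<delta> prior \<longrightarrow>
        real q < (2 * \<pi> - 1) * real (card (spike_columns nbar d)) \<longrightarrow>
        \<not> (\<exists>R. estimates_cur_errors d L h Is Js \<delta> prior \<pi> q R)) \<and>
     (\<exists>c>0. \<forall>mbar nbar d L h Is Js F eps \<delta> (prior :: nat \<Rightarrow> 'p) q R.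
        spiked_cur_family mbar nbar d L h Is Js F eps \<delta> prior \<longrightarrow>
        estimates_cur_errors d L h Is Js \<delta> prior \<pi> q R \<longrightarrow>
        real q \<ge> c * real (card (spike_columns nbar d)) \<and> real q \<ge> c * real d)"
proof -
  have bound: "(2 * \<pi> - 1) * real d \<le> real q"
    if "spiked_cur_family mbar nbar d L h Is Js F eps \<delta> prior"
      "estimates_cur_errors d L h Is Js \<delta> prior \<pi> q R"
    for mbar nbar d L h Is Js F eps \<delta> q R and "prior" :: "nat \<Rightarrow> 'p"
    using spiked_cur_family.query_lower_bound[OF that] assms by (simp add: mult.commute)
  show ?thesis
  \<comment> \<open>The factor from the double count serves as the constant; it depends on \<pi>
    alone and is positive because \<pi> exceeds 1/2.\<close>
  proof (intro conjI exI[of _ "2 * \<pi> - 1"])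
    show "0 < 2 * \<pi> - 1" using assms by simp
  qed (unfold card_spike_columns, (meson bound not_le)+)
qed

end
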